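(* Let $p$ be a prime, $q=p^l$, $m\ge1$, $n=2m$. Let $0\leqslant r\leqslant n(q-1)-2$ and write $r=\rho(q-1)+s$ with $0\leqslant\rho\leqslant n-1$, $0\leqslant s<q-1$. Let $I\subseteq M_{r+1}$. Denote by $\mathrm{dist}$ the minimum Hamming distance. \begin{enumerate} \item If $\rho=n-1$ and $\{q-1-s-1\}\cap I=\emptyset$, then $\mathrm{dist}(\mathcal{C}_q(r+1,I,n))=q-s$. \item Let $0\leqslant\rho\leqslant n-2$. If either $\rho$ is odd and $\{q-1-s+1,\,q-1-s-1\}\cap I=\emptyset$, or $\rho$ is even and $\{|s+1|,|s-1|\}\cap I=\emptyset$, then $\mathrm{dist}(\mathcal{C}_q(r+1,I,n))=(q-s)q^{n-\rho-1}$. If either $\rho$ is odd and $\{q-1-s+1,\,q-1-s-1\}\cap I=\{q-1-s+1\}$, or $\rho$ is even, $s\neq0$ and $\{|s+1|,|s-1|\}\cap I=\{|s-1|\}$, then $\mathrm{dist}(\mathcal{C}_q(r+1,I,n))\geqslant(q^2-qs-1)q^{n-\rho-2}$. \end{enumerate}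
   Context: Let $N=q^n-1$ and $\alpha$ a primitive element of $\mathbb{F}_{q^n}$. Every integer $0\le u\le q^n-1$ is written $u=\sum_{i=0}^{n-1}u_iq^i$, $u_i\in\{0,\dots,q-1\}$; $\mathrm{wt}_q(u)=\sum u_i$, $O(u)=\sum_{i\text{ odd}}u_i$, $E(u)=\sum_{i\text{ even}}u_i$. For $-1\le r<n(q-1)$, $Z_r=\{\alpha^u\mid 0<u\le q^n-1,\ \mathrm{wt}_q(u)\le n(q-1)-r-1\}$. For $0\le r\le n(q-1)$ and integer $k\ge0$, $\Theta^{(r)}_k=\{\alpha^u\mid 0\le u\le q^n-1,\ \mathrm{wt}_q(u)=n(q-1)-r,\ |O(u)-E(u)|=k\}$. $M_r$ is the set of even (resp. odd) integers $k\in[0,m(q-1)]$ when $r$ is even (resp. odd). For $0\le r<n(q-1)$ and $I\subseteq M_r$: $\overline I=M_r\setminus I$, $Z_{r,I}=Z_r\cup\bigcup_{k\in\overline I}\Theta^{(r)}_k$. A cyclic code of length $N$ over $\mathbb{F}_q$ with zero set $Z$ is $\{(c_0,\dots,c_{N-1})\in\mathbb{F}_q^N\mid \sum_ic_i\beta^i=0\ \forall\beta\in Z\}$. $\mathcal{C}_q(r,I,n)^*$ is the cyclic code with zero set $Z_{r,I}$ and $\mathcal{C}_q(r,I,n)$ its extended code (append the coordinate $-\sum_ic_i$). By convention, $\mathcal{C}_q(n(q-1),I,n)$ equals the extended code of the cyclic code with zero set $Z_{n(q-1)-1}$ if $0\notin I$, and $\mathbb{F}_q^{q^n}$ if $0\in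 I$. *)

theory Defs
  imports "HOL-Computational_Algebra.Primes"
begin

text \<open>The ambient field F_{q^n} is a finite field type 'b of cardinality q^n;
  F_q is realised as its subfield of elements x with x^q = x.\<close>

definition primitive_elem :: "'b::{field,finite} \<Rightarrow> bool" where
  "primitive_elem a \<longleftrightarrow> a \<noteq> 0 \<and> (\<forall>x. x \<noteq> 0 \<longrightarrow> (\<exists>i::nat. x = a ^ i))"

definition qdigit :: "nat \<Rightarrow> nat \<Rightarrow> nat \<Rightarrow> nat" where
  "qdigit q i u = u div q ^ i mod q"

definition wtq :: "nat \<Rightarrow> nat \<Rightarrow> nat \<Rightarrow> nat" where
  "wtq q n u = (\<Sum>i<n. qdigit q i u)"

definition Oq :: "nat \<Rightarrow> nat \<Rightarrow> nat \<Rightarrow> nat" where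
  "Oq q n u = (\<Sum>i\<in>{i. i < n \<and> odd i}. qdigit q i u)"

definition Eq :: "nat \<Rightarrow> nat \<Rightarrow> nat \<Rightarrow> nat" where
  "Eq q n u = (\<Sum>i\<in>{i. i < n \<and> even i}. qdigit q i u)"

definition Zset :: "nat \<Rightarrow> nat \<Rightarrow> 'b::{field,finite} \<Rightarrow> int \<Rightarrow> 'b set" where
  "Zset q n \<alpha> r = {\<alpha> ^ u | u. 0 < u \<and> u \<le> q ^ n - 1 \<and>
       int (wtq q n u) \<le> int n * (int q - 1) - r - 1}"

definition Theta :: "nat \<Rightarrow> nat \<Rightarrow> 'b::{field,finite} \<Rightarrow> int \<Rightarrow> int \<Rightarrow> 'b set" where
  "Theta q n \<alpha> r k = {\<alpha> ^ u | u. u \<le> q ^ n - 1 \<and>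
       int (wtq q n u) = int n * (int q - 1) - r \<and>
       \<bar>int (Oq q n u) - int (Eq q n u)\<bar> = k}"

definition Mset :: "nat \<Rightarrow> nat \<Rightarrow> int \<Rightarrow> int set" where
  "Mset q m r = {k. 0 \<le> k \<and> k \<le> int m * (int q - 1) \<and> (even k \<longleftrightarrow> even r)}"

definition ZrI :: "nat \<Rightarrow> nat \<Rightarrow> nat \<Rightarrow> 'b::{field,finite} \<Rightarrow> int \<Rightarrow> int set \<Rightarrow> 'b set" where
  "ZrI q m n \<alpha> r I = Zset q n \<alpha> r \<union> (\<Union>k \<in> Mset q m r - I. Theta q n \<alpha> r k)"

text \<open>Cyclic code of length N = q^n - 1 over F_q (subfield of 'b) with zero set Z.
  Codewords are functions nat => 'b, zero outside the index range {0..<N}.\<close>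
definition cyclic_code :: "nat \<Rightarrow> nat \<Rightarrow> 'b::{field,finite} set \<Rightarrow> (nat \<Rightarrow> 'b) set" where
  "cyclic_code q n Z = {c. (\<forall>i < q ^ n - 1. c i ^ q = c i) \<and> (\<forall>i \<ge> q ^ n - 1. c i = 0) \<and>
       (\<forall>\<beta>\<in>Z. (\<Sum>i < q ^ n - 1. c i * \<beta> ^ i) = 0)}"

definition extend_word :: "nat \<Rightarrow> (nat \<Rightarrow> 'b::field) \<Rightarrow> nat \<Rightarrow> 'b" where
  "extend_word N c = (\<lambda>i. if i < N then c i else if i = N then - (\<Sum>j<N. c j) else 0)"

definition extended_code :: "nat \<Rightarrow> (nat \<Rightarrow> 'b::field) set \<Rightarrow> (nat \<Rightarrow> 'b) set" where
  "extended_code N C = extend_word N ` C"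

text \<open>C_q(r,I,n) for 0 <= r < n(q-1)\<close>
definition Cq :: "nat \<Rightarrow> nat \<Rightarrow> nat \<Rightarrow> 'b::{field,finite} \<Rightarrow> int \<Rightarrow> int set \<Rightarrow> (nat \<Rightarrow> 'b) set" where
  "Cq q m n \<alpha> r I = extended_code (q ^ n - 1) (cyclic_code q n (ZrI q m n \<alpha> r I))"

definition min_dist :: "nat \<Rightarrow> (nat \<Rightarrow> 'b) set \<Rightarrow> nat" where
  "min_dist len C = Min {card {i. i < len \<and> c i \<noteq> d i} | c d. c \<in> C \<and> d \<in> C \<and> c \<noteq> d}"

end

theory Submission
  imports Defs "HOL-Library.FuncSet"
begin

text \<open>
  Put \<open>k = n - \<rho> - 1\<close>. An exponent \<open>0 < u < (q - s) q\<^sup>k - 1\<close> has weight at most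
  \<open>n(q - 1) - r - 1\<close>. Equality means that \<open>u\<close> is \<open>(q - s - 1) q\<^sup>k - 1\<close>, or that its digit at
  position \<open>k\<close> is \<open>q - s - 1\<close> and its lower digits are \<open>q - 1\<close> except for a single \<open>q - 2\<close>;
  the position of that digit decides between the two values of \<open>\<bar>O(u) - E(u)\<bar>\<close> in the hypotheses.
  So the BCH bound gives the lower bounds; if only one of the two values is excluded, the first
  exponent that can fail to be a zero is the one with \<open>q - 2\<close> at position \<open>k - 1\<close>.

  The bound is attained by a function supported on an \<open>F\<^sub>q\<close>-subspace of dimension \<open>k + 1\<close>,
  equal there to a product of \<open>s\<close> factors \<open>t\<^sub>k - b\<close> in the last coordinate: its power sums
  are sums over \<open>F\<^sub>q\<^bsup>k+1\<^esup>\<close> of polynomials of degree less than \<open>(k + 1)(q - 1)\<close>, hence zero.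
\<close>

subsection \<open>Digits of small exponents\<close>

text \<open>This is \<open>Eq\<close> minus \<open>Oq\<close>. As one alternating sum it obeys a
  recursion that splits off the leading digit.\<close>

definition signed_wt :: "nat \<Rightarrow> nat \<Rightarrow> nat \<Rightarrow> int" where
  "signed_wt q n u = (\<Sum>i<n. (- 1) ^ i * int (qdigit q i u))"

lemma qdigit_mod_power:
  assumes "i < k"
  shows "qdigit q i (u mod q ^ k) = qdigit q i u"
proof -
  from assms obtain j where k: "k = i + Suc j"
    using less_imp_Suc_add by (metis add_Suc_right)
  have "u mod q ^ k = q ^ i * (u div q ^ i mod q ^ Suc j) + u mod q ^ i"
    unfolding k power_add by (rule mod_mult2_eq)
  then show ?thesis
    by (cases "q = 0") (simp_all add: qdigit_def k mod_mod_cancel)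
qed

lemma qdigit_eq_0: "u < q ^ i \<Longrightarrow> qdigit q i u = 0"
  by (simp add: qdigit_def)

lemma qdigit_top: "u < q ^ Suc k \<Longrightarrow> qdigit q k u = u div q ^ k"
  by (simp add: qdigit_def less_mult_imp_div_less)

lemma wtq_Suc: "u < q ^ Suc k \<Longrightarrow> wtq q (Suc k) u = wtq q k (u mod q ^ k) + u div q ^ k"
  by (simp add: wtq_def qdigit_mod_power qdigit_top)

lemma signed_wt_Suc:
  "u < q ^ Suc k \<Longrightarrow>
    signed_wt q (Suc k) u = signed_wt q k (u mod q ^ k) + (- 1) ^ k * int (u div q ^ k)"
  by (simp add: signed_wt_def qdigit_mod_power qdigit_top)

lemma wtq_extend:
  assumes "u < q ^ k" "k \<le> n" "0 < q"
  shows "wtq q n u = wtq q k u"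
proof -
  have "qdigit q i u = 0" if "k \<le> i" for i
    using assms that power_increasing[of k i q] by (intro qdigit_eq_0) simp
  then show ?thesis
    unfolding wtq_def using assms by (intro sum.mono_neutral_right) auto
qed

lemma signed_wt_extend:
  assumes "u < q ^ k" "k \<le> n" "0 < q"
  shows "signed_wt q n u = signed_wt q k u"
proof -
  have "qdigit q i u = 0" if "k \<le> i" for i
    using assms that power_increasing[of k i q] by (intro qdigit_eq_0) simp
  then show ?thesis
    unfolding signed_wt_def using assms by (intro sum.mono_neutral_right) auto
qed

lemma Eq_plus_Oq: "Eq q n u + Oq q n u = wtq q n u"
  unfolding Eq_def Oq_def wtq_def
  by (subst sum.union_disjoint [symmetric]) (auto intro!: sum.cong)

lemma Eq_minus_Oq: "int (Eq q n u) - int (Oq q n u) = signed_wt q n u"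
proof -
  have "signed_wt q n u = (\<Sum>i\<in>{i. i < n \<and> even i} \<union> {i. i < n \<and> odd i}. (- 1) ^ i * int (qdigit q i u))"
    unfolding signed_wt_def by (intro sum.cong) auto
  also have "\<dots> = (\<Sum>i\<in>{i. i < n \<and> even i}. int (qdigit q i u)) +
      (\<Sum>i\<in>{i. i < n \<and> odd i}. - int (qdigit q i u))"
    by (subst sum.union_disjoint) (auto intro!: arg_cong2[where f = "(+)"] sum.cong)
  finally show ?thesis
    by (simp add: Eq_def Oq_def sum_negf)
qed

lemma card_even_odd_below:
  "card {i. i < 2 * m \<and> even i} = m" "card {i. i < 2 * m \<and> odd i} = m" for m :: nat
proof -
  have "{i. i < 2 * m \<and> even i} = (\<lambda>j. 2 * j) ` {..<m}"
    by (auto elim!: evenE)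
  then show "card {i. i < 2 * m \<and> even i} = m"
    by (simp add: card_image inj_on_def)
  have "{i. i < 2 * m \<and> odd i} = (\<lambda>j. 2 * j + 1) ` {..<m}"
    by (auto elim!: oddE)
  then show "card {i. i < 2 * m \<and> odd i} = m"
    by (simp add: card_image inj_on_def)
qed

text \<open>The \<open>2 * m\<close> positions split evenly, so neither sum exceeds
  \<open>m * (q - 1)\<close>, and their total \<open>2 * m * (q - 1) - r\<close> has the parity of
  \<open>r\<close>. Thus in \<open>ZrI\<close> no exponent of critical weight falls outside the
  index set from which \<open>I\<close> is removed.\<close>

lemma abs_Oq_minus_Eq_in_Mset:
  assumes "0 < q" "int (wtq q (2 * m) u) = int (2 * m) * (int q - 1) - r"
  shows "\<bar>int (Oq q (2 * m) u) - int (Eq q (2 * m) u)\<bar> \<in> Mset q m r"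
proof -
  let ?O = "int (Oq q (2 * m) u)" and ?E = "int (Eq q (2 * m) u)"
  have digit: "qdigit q i u \<le> q - 1" for i
    using assms(1) by (simp add: qdigit_def Suc_leI flip: less_Suc_eq_le)
  have "Oq q (2 * m) u \<le> m * (q - 1)" "Eq q (2 * m) u \<le> m * (q - 1)"
    unfolding Oq_def Eq_def
    using sum_bounded_above[of "{i. i < 2 * m \<and> odd i}", OF digit]
      sum_bounded_above[of "{i. i < 2 * m \<and> even i}", OF digit]
    by (simp_all add: card_even_odd_below)
  then have "?O \<le> int m * (int q - 1)" "?E \<le> int m * (int q - 1)"
    using assms(1) by (metis of_nat_le_iff of_nat_mult of_nat_1 of_nat_diff Suc_leI One_nat_def)+
  then have "\<bar>?O - ?E\<bar> \<le> int m * (int q - 1)"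
    by linarith
  moreover have "?E + ?O = 2 * (int m * (int q - 1)) - r"
    using assms(2) Eq_plus_Oq[of q "2 * m" u] by (simp flip: of_nat_add)
  then have "even (\<bar>?O - ?E\<bar>) \<longleftrightarrow> even r"
    by presburger
  ultimately show ?thesis
    by (simp add: Mset_def)
qed

text \<open>The value of \<open>signed_wt q k\<close> at \<open>q ^ k - 1\<close>, whose digits are all \<open>q - 1\<close>.\<close>

definition max_signed_wt :: "nat \<Rightarrow> nat \<Rightarrow> int" where
  "max_signed_wt q k = (if even k then 0 else int q - 1)"

lemma wtq_le:
  assumes "0 < q"
  shows "int (wtq q k u) \<le> int k * (int q - 1)"
proof -
  have "qdigit q i u \<le> q - 1" for i
    using assms by (simp add: qdigit_def Suc_leI flip: less_Suc_eq_le)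
  then have "wtq q k u \<le> k * (q - 1)"
    unfolding wtq_def using sum_bounded_above[of "{..<k}" "\<lambda>i. qdigit q i u" "q - 1"] by simp
  then show ?thesis
    using assms by (metis of_nat_le_iff of_nat_mult of_nat_1 of_nat_diff Suc_leI One_nat_def)
qed

text \<open>Weight one below the maximum means that a single digit is \<open>q - 2\<close> and all
  others are \<open>q - 1\<close>, which moves the alternating sum by one. In the induction the
  deficit sits either in the leading digit or in the tail.\<close>

lemma wtq_near_max:
  assumes "0 < q" "u < q ^ k"
  shows "(u \<noteq> q ^ k - 1 \<longrightarrow> int (wtq q k u) < int k * (int q - 1)) \<and>
    (int (wtq q k u) = int k * (int q - 1) \<longrightarrow> signed_wt q k u = max_signed_wt q k) \<and>
    (int (wtq q k u) = int k * (int q - 1) - 1 \<longrightarrow> \<bar>signed_wt q k u - max_signed_wt q k\<bar> = 1)"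
  using assms(2)
proof (induction k arbitrary: u)
  case 0
  then show ?case
    by (simp add: signed_wt_def wtq_def max_signed_wt_def)
next
  case (Suc k)
  define v b where "v = u mod q ^ k" and "b = u div q ^ k"
  have v: "v < q ^ k" and b: "b < q" and u: "u = b * q ^ k + v"
    using assms(1) Suc.prems by (simp_all add: v_def b_def less_mult_imp_div_less div_mult_mod_eq)
  note IH = Suc.IH[OF v]
  have wt: "int (wtq q (Suc k) u) = int (wtq q k v) + int b"
    using wtq_Suc[OF Suc.prems] by (simp add: v_def b_def)
  have sw: "signed_wt q (Suc k) u = signed_wt q k v + (- 1) ^ k * int b"
    using signed_wt_Suc[OF Suc.prems] by (simp add: v_def b_def)
  have le: "int (wtq q k v) \<le> int k * (int q - 1)" by (rule wtq_le[OF assms(1)])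
  have dist: "int (Suc k) * (int q - 1) = int k * (int q - 1) + (int q - 1)"
    by (simp add: algebra_simps)
  have 1: "int (wtq q (Suc k) u) < int (Suc k) * (int q - 1)" if "u \<noteq> q ^ Suc k - 1"
  proof (cases "b = q - 1")
    case True
    have "v \<noteq> q ^ k - 1"
    proof
      assume "v = q ^ k - 1"
      then have "u = q ^ Suc k - 1"
        using True u v assms(1) by (cases q) simp_all
      with that show False by simp
    qed
    with IH have "int (wtq q k v) < int k * (int q - 1)" by blast
    then show ?thesis using wt b unfolding dist by linarith
  next
    case False
    with b have "int b < int q - 1" by linarith
    then show ?thesis using wt le unfolding dist by linarith
  qed
  have 2: "signed_wt q (Suc k) u = max_signed_wt q (Suc k)"
    if "int (wtq q (Suc k) u) = int (Suc k) * (int q - 1)"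
  proof -
    have "int b = int q - 1" "int (wtq q k v) = int k * (int q - 1)"
      using that wt b le unfolding dist by linarith+
    then show ?thesis using IH sw by (auto simp: max_signed_wt_def)
  qed
  have 3: "\<bar>signed_wt q (Suc k) u - max_signed_wt q (Suc k)\<bar> = 1"
    if "int (wtq q (Suc k) u) = int (Suc k) * (int q - 1) - 1"
  proof (cases "int b = int q - 1")
    case True
    then have "int (wtq q k v) = int k * (int q - 1) - 1"
      using that wt b le unfolding dist by linarith
    then show ?thesis using IH sw True by (auto simp: max_signed_wt_def)
  next
    case False
    then have "int b = int q - 2" "int (wtq q k v) = int k * (int q - 1)"
      using that wt b le unfolding dist by linarith+
    then show ?thesis using IH sw by (auto simp: max_signed_wt_def)
  qed
  from 1 2 3 show ?case by blast
qed

text \<open>The number \<open>q ^ Suc k - q ^ k - 1\<close> has leading digit \<open>q - 2\<close>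
  and all other digits \<open>q - 1\<close>. It is the smallest one whose weight misses the maximum
  by at most one.\<close>

lemma wtq_two_below_max:
  assumes "0 < q" "u + q ^ k + 1 < q ^ Suc k"
  shows "int (wtq q (Suc k) u) \<le> int (Suc k) * (int q - 1) - 2"
proof -
  define v b where "v = u mod q ^ k" and "b = u div q ^ k"
  have u: "u = b * q ^ k + v" and v: "v < q ^ k" and less: "u < q ^ Suc k"
    using assms by (simp_all add: v_def b_def div_mult_mod_eq)
  have below: "(b + 1) * q ^ k + v + 1 < q * q ^ k"
    using assms(2) u by (simp add: algebra_simps)
  then have "(b + 1) * q ^ k < q * q ^ k"
    by linarith
  then have b: "b + 1 < q"
    by (metis mult_less_cancel2)
  have wt: "int (wtq q (Suc k) u) = int (wtq q k v) + int b"
    using wtq_Suc[OF less] by (simp add: v_def b_def)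
  have dist: "int (Suc k) * (int q - 1) = int k * (int q - 1) + (int q - 1)"
    by (simp add: algebra_simps)
  show ?thesis
  proof (cases "q = b + 2")
    case True
    then have "v \<noteq> q ^ k - 1"
      using below by (auto simp: algebra_simps)
    then have "int (wtq q k v) < int k * (int q - 1)"
      using wtq_near_max[OF assms(1) v] by blast
    then show ?thesis using wt True unfolding dist by linarith
  next
    case False
    then show ?thesis
      using wt b wtq_le[OF assms(1), of k v] unfolding dist by linarith
  qed
qed

text \<open>The leading digit is at most \<open>q - s - 1\<close>. Either it has this value and the
  lower digits lose at least one, or it loses at least one itself. The stricter bound in the third
  part makes the lower digits lose two in the first case, which leaves leading digit
  \<open>q - s - 2\<close> over digits \<open>q - 1\<close>.\<close>

lemma small_exponent_weight:
  assumes "Suc k \<le> n" "s + 2 \<le> q" "u + 1 < (q - s) * q ^ k"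
  defines "W \<equiv> int (Suc k) * (int q - 1) - int s - 1"
  shows "int (wtq q n u) \<le> W"
    and "int (wtq q n u) = W \<Longrightarrow>
      \<bar>signed_wt q n u\<bar> \<in> (if even k then {int q - int s, int q - int s - 2} else {int s + 1, \<bar>int s - 1\<bar>})"
    and "int (wtq q n u) = W \<Longrightarrow> 0 < k \<Longrightarrow> u + q ^ (k - 1) + 1 < (q - s) * q ^ k \<Longrightarrow>
      \<bar>signed_wt q n u\<bar> = (if even k then int q - int s - 2 else int s + 1)"
proof -
  define v b where "v = u mod q ^ k" and "b = u div q ^ k"
  have q: "0 < q" using assms(2) by simp
  then have u: "u = b * q ^ k + v" and v: "v < q ^ k"
    by (simp_all add: v_def b_def div_mult_mod_eq)
  have "(q - s) * q ^ k \<le> q * q ^ k" by simp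
  with assms(3) have less: "u < q ^ Suc k" unfolding power_Suc by linarith
  have "b * q ^ k < (q - s) * q ^ k" using assms(3) u by linarith
  then have "b < q - s" by (metis mult_less_cancel2)
  then have b: "b + s + 1 \<le> q" by linarith
  have wt: "int (wtq q n u) = int (wtq q k v) + int b"
    using wtq_Suc[OF less] wtq_extend[OF less assms(1) q] by (simp add: v_def b_def)
  have sw: "signed_wt q n u = signed_wt q k v + (- 1) ^ k * int b"
    using signed_wt_Suc[OF less] signed_wt_extend[OF less assms(1) q] by (simp add: v_def b_def)
  have W: "W = int k * (int q - 1) + int q - int s - 2"
    by (simp add: W_def algebra_simps)
  note near = wtq_near_max[OF q v]
  \<comment> \<open>Equality would give \<open>u = (q - s) * q ^ k - 1\<close>, the first exponent
    that the strict bound excludes.\<close>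
  have top: "v \<noteq> q ^ k - 1" if "b + s + 1 = q"
  proof
    assume "v = q ^ k - 1"
    then have "u + 1 = (b + 1) * q ^ k" using v u by simp
    moreover have "b + 1 = q - s" using that by simp
    ultimately have "u + 1 = (q - s) * q ^ k" by (simp only:)
    then show False using assms(3) by simp
  qed
  have "(b + s + 1 = q \<and> int (wtq q k v) \<le> int k * (int q - 1) - 1) \<or>
    (b + s + 2 \<le> q \<and> int (wtq q k v) \<le> int k * (int q - 1))"
  proof (cases "b + s + 1 = q")
    case True
    with near top have "int (wtq q k v) < int k * (int q - 1)" by blast
    with True show ?thesis by linarith
  next
    case False
    with b wtq_le[OF q, of k v] show ?thesis by linarith
  qed
  then consider (max) "b + s + 1 = q" "int (wtq q k v) \<le> int k * (int q - 1) - 1"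
    | (below) "b + s + 2 \<le> q" "int (wtq q k v) \<le> int k * (int q - 1)"
    by blast
  note cs = this
  from cs show "int (wtq q n u) \<le> W"
    unfolding wt W by cases linarith+
  have eq_below: "\<bar>signed_wt q n u\<bar> = (if even k then int q - int s - 2 else int s + 1)"
    if "int (wtq q n u) = W" "b + s + 2 \<le> q"
  proof -
    have "int (wtq q k v) = int k * (int q - 1)" "int b = int q - int s - 2"
      using that wtq_le[OF q, of k v] unfolding wt W by linarith+
    then show ?thesis using near unfolding sw max_signed_wt_def by auto
  qed
  show "\<bar>signed_wt q n u\<bar> \<in> (if even k then {int q - int s, int q - int s - 2} else {int s + 1, \<bar>int s - 1\<bar>})"
    if eq: "int (wtq q n u) = W"
    using cs
  proof cases
    case max
    then have "int b = int q - int s - 1" "int (wtq q k v) = int k * (int q - 1) - 1"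
      using eq unfolding wt W by linarith+
    with near have "\<bar>signed_wt q k v - max_signed_wt q k\<bar> = 1" by blast
    with \<open>int b = _\<close> assms(2) show ?thesis unfolding sw max_signed_wt_def by auto
  next
    case below
    show ?thesis using eq_below[OF eq below(1)] by simp
  qed
  show "\<bar>signed_wt q n u\<bar> = (if even k then int q - int s - 2 else int s + 1)"
    if eq: "int (wtq q n u) = W" and k: "0 < k" and small: "u + q ^ (k - 1) + 1 < (q - s) * q ^ k"
    using cs
  proof cases
    case max
    obtain k' where k': "k = Suc k'" using k by (cases k) auto
    have "q - s = b + 1" using max(1) by simp
    then have "v + q ^ k' + 1 < q ^ Suc k'"
      using small u by (simp add: k')
    then have "int (wtq q k v) \<le> int k * (int q - 1) - 2"
      using wtq_two_below_max[OF q] by (simp add: k')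
    then show ?thesis using max(1) eq unfolding wt W by linarith
  next
    case below
    show ?thesis using eq_below[OF eq below(1)] .
  qed
qed

subsection \<open>The BCH bound\<close>

text \<open>Splitting one factor \<open>X i - b\<close> gives a sum with exponent
  \<open>Suc w\<close> and a multiple of one with exponent \<open>w\<close>, each with one factor
  fewer. The lemma serves both the BCH bound and the sums over \<open>K\<close>.\<close>

lemma prod_diff_power_sum_eq_0:
  fixes X c :: "'i \<Rightarrow> 'a::comm_ring_1"
  assumes "finite B" "w + card B < d" "\<And>u. u < d \<Longrightarrow> (\<Sum>i\<in>A. c i * X i ^ u) = 0"
  shows "(\<Sum>i\<in>A. c i * ((\<Prod>b\<in>B. X i - b) * X i ^ w)) = 0"
  using assms(1,2)
proof (induction B arbitrary: w rule: finite_induct)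
  case empty
  then show ?case using assms(3) by simp
next
  case (insert b B)
  have "(\<Sum>i\<in>A. c i * ((\<Prod>b\<in>insert b B. X i - b) * X i ^ w)) =
    (\<Sum>i\<in>A. c i * ((\<Prod>b\<in>B. X i - b) * X i ^ Suc w)) -
    b * (\<Sum>i\<in>A. c i * ((\<Prod>b\<in>B. X i - b) * X i ^ w))"
    using insert.hyps by (simp add: sum_distrib_left algebra_simps flip: sum_subtractf)
  also have "\<dots> = 0"
    using insert.IH[of "Suc w"] insert.IH[of w] insert.prems insert.hyps by simp
  finally show ?case .
qed

text \<open>Instead of a Vandermonde determinant: the vanishing power sums are tested against the polynomial
  whose roots are all locators in the support but one.\<close>

lemma bch_bound:
  fixes X c :: "'i \<Rightarrow> 'a::idom"
  assumes "finite A" "inj_on X A" "A \<noteq> {}" "\<And>i. i \<in> A \<Longrightarrow> c i \<noteq> 0"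
    and "\<And>u. u < d \<Longrightarrow> (\<Sum>i\<in>A. c i * X i ^ u) = 0"
  shows "d < card A"
proof (rule ccontr)
  assume "\<not> d < card A"
  obtain k where k: "k \<in> A" using assms(3) by blast
  have "card A > 0"
    using assms(1,3) by (simp add: card_gt_0_iff)
  define B where "B = X ` (A - {k})"
  have B: "finite B" "0 + card B < d"
    using assms(1) k card_image_le[of "A - {k}" X] \<open>\<not> d < card A\<close> \<open>card A > 0\<close>
    by (auto simp: B_def)
  have "0 = (\<Sum>i\<in>A. c i * ((\<Prod>b\<in>B. X i - b) * X i ^ 0))"
    using prod_diff_power_sum_eq_0[OF B assms(5)] by simp
  also have "\<dots> = (\<Sum>i\<in>{k}. c i * ((\<Prod>b\<in>B. X i - b) * X i ^ 0))"
    using assms(1) k B(1) by (intro sum.mono_neutral_right) (auto simp: B_def)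
  finally have "(\<Prod>b\<in>B. X k - b) = 0"
    using assms(4)[OF k] by simp
  then have "X k \<in> B"
    using B(1) by auto
  then show False
    using assms(2) k by (auto simp: B_def inj_on_def)
qed

subsection \<open>Low degree functions on a subspace\<close>

text \<open>Each \<open>x ^ q ^ i\<close> will be linear over \<open>K\<close> in \<open>x\<close>,
  so \<open>x ^ u\<close> becomes a product of \<open>wtq q n u\<close> linear forms.\<close>

lemma power_eq_prod_qdigit:
  fixes x :: "'a::comm_monoid_mult"
  assumes "u < q ^ n"
  shows "x ^ u = (\<Prod>i<n. (x ^ q ^ i) ^ qdigit q i u)"
  using assms
proof (induction n arbitrary: u)
  case 0
  then show ?case by simp
next
  case (Suc n)
  then have "0 < q" by (cases q) auto
  then have "u mod q ^ n < q ^ n" by simp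
  have "x ^ u = x ^ (u mod q ^ n) * (x ^ q ^ n) ^ (u div q ^ n)"
    by (simp flip: power_mult power_add)
  then show ?case
    using Suc.IH[OF \<open>u mod q ^ n < q ^ n\<close>] Suc.prems by (simp add: qdigit_mod_power qdigit_top)
qed

section \<open>The ambient field: characteristic, powers of \<open>\<alpha>\<close>, and the
  subfield \<open>K\<close>\<close>

lemma prime_CHAR_finite_field: "prime CHAR('b::{field,finite})"
  by (rule prime_CHAR_semidom) (simp add: finite_imp_CHAR_pos)

text \<open>Translation by 1 permutes the field, so comparing the sums of all elements shows that
  the cardinality vanishes in the field.\<close>

lemma finite_field_CHAR_eq:
  assumes "card (UNIV :: 'b::{field,finite} set) = p ^ k" "prime p"
  shows "CHAR('b) = p"
proof -
  have "(\<Sum>x\<in>(UNIV :: 'b set). x) = (\<Sum>x\<in>UNIV. x + 1)"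
    by (rule sum.reindex_bij_witness[of _ "\<lambda>x. x + 1" "\<lambda>x. x - 1"]) auto
  then have "of_nat (p ^ k) = (0 :: 'b)"
    using assms(1) by (simp add: sum.distrib)
  then have "CHAR('b) dvd p ^ k"
    by (simp only: of_nat_eq_0_iff_char_dvd)
  then show ?thesis
    using prime_CHAR_finite_field assms(2) prime_dvd_power primes_dvd_imp_eq by blast
qed

lemma geometric_sum_nat: "0 < q \<Longrightarrow> (q - 1) * (\<Sum>i<n. q ^ i) = q ^ n - 1" for q :: nat
proof (induction n)
  case (Suc n)
  then show ?case
    by (cases q) (simp_all add: algebra_simps)
qed simp

locale finite_extension =
  fixes q n :: nat and \<alpha> :: "'b::{field,finite}"
  assumes card_UNIV: "card (UNIV :: 'b set) = q ^ n"
    and q_power_CHAR: "\<exists>l. q = CHAR('b) ^ l"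
    and q_ge_2: "2 \<le> q" and n_pos: "0 < n"
    and primitive: "primitive_elem \<alpha>"
begin

definition K :: "'b set" where "K = {x. x ^ q = x}"

lemma power_q_sum: "sum f A ^ q ^ j = (\<Sum>i\<in>A. (f i :: 'b) ^ q ^ j)"
proof -
  obtain l where "q = CHAR('b) ^ l" using q_power_CHAR by blast
  then have "q ^ j = CHAR('b) ^ (l * j)" by (simp add: power_mult)
  then show ?thesis using freshmans_dream_sum'[OF prime_CHAR_finite_field] by blast
qed

lemma power_q_add: "(x + y :: 'b) ^ q = x ^ q + y ^ q"
  using q_power_CHAR freshmans_dream'[OF prime_CHAR_finite_field] by blast

lemma of_nat_q: "of_nat q = (0 :: 'b)"
proof -
  obtain l where l: "q = CHAR('b) ^ l" using q_power_CHAR by blast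
  with q_ge_2 have "l \<noteq> 0" by (intro notI) simp
  then show ?thesis by (simp add: l)
qed

lemma K_0: "0 \<in> K" and K_1: "1 \<in> K"
  and K_mult: "x \<in> K \<Longrightarrow> y \<in> K \<Longrightarrow> x * y \<in> K"
  and K_divide: "x \<in> K \<Longrightarrow> y \<in> K \<Longrightarrow> x / y \<in> K"
  and K_power: "x \<in> K \<Longrightarrow> x ^ j \<in> K"
  using q_ge_2 by (auto simp: K_def power_mult_distrib power_divide)
    (metis power_mult mult.commute)

lemma K_diff: "x \<in> K \<Longrightarrow> y \<in> K \<Longrightarrow> x - y \<in> K"
  \<comment> \<open>Additivity applied to \<open>(x - y) + y\<close> sidesteps the sign of
    \<open>(- 1) ^ q\<close>.\<close>
  using power_q_add[of "x - y" y] by (simp add: K_def) (metis add_diff_cancel_right')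

lemma K_prod: "(\<And>i. i \<in> A \<Longrightarrow> f i \<in> K) \<Longrightarrow> prod f A \<in> K"
  by (induction A rule: infinite_finite_induct) (auto simp: K_1 intro!: K_mult)

lemma alpha_nonzero: "\<alpha> \<noteq> 0"
  using primitive by (simp add: primitive_elem_def)

text \<open>The pigeonhole principle gives \<open>\<alpha>\<close> a finite order \<open>d\<close>.
  Powers below \<open>d\<close> are distinct and every power reduces modulo \<open>d\<close>, so
  \<open>d\<close> counts the nonzero elements.\<close>

lemma alpha_power_bij: "bij_betw (\<lambda>i. \<alpha> ^ i) {..<q ^ n - 1} (UNIV - {0})"
proof -
  have "\<not> inj (\<lambda>i::nat. \<alpha> ^ i)"
    using finite_imageD[of "\<lambda>i::nat. \<alpha> ^ i" UNIV] by auto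
  then obtain i j where "i < j" "\<alpha> ^ i = \<alpha> ^ j"
    unfolding inj_on_def by (metis linorder_neqE_nat)
  then have "\<alpha> ^ (j - i) = 1"
    using alpha_nonzero power_add[of \<alpha> i "j - i"] by simp
  with \<open>i < j\<close> have ex: "\<exists>d. 0 < d \<and> \<alpha> ^ d = 1"
    by (intro exI[of _ "j - i"]) simp
  define d where "d = (LEAST d. 0 < d \<and> \<alpha> ^ d = 1)"
  have d: "0 < d" "\<alpha> ^ d = 1" and least: "\<And>e. 0 < e \<Longrightarrow> \<alpha> ^ e = 1 \<Longrightarrow> d \<le> e"
    using LeastI_ex[OF ex] unfolding d_def by (auto intro: Least_le)
  have inj: "inj_on (\<lambda>i. \<alpha> ^ i) {..<d}"
  proof (rule linorder_inj_onI')
    fix i j assume ij: "i \<in> {..<d}" "j \<in> {..<d}" "i < j"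
    show "\<alpha> ^ i \<noteq> \<alpha> ^ j"
    proof
      assume "\<alpha> ^ i = \<alpha> ^ j"
      then have "\<alpha> ^ (j - i) = 1"
        using alpha_nonzero power_add[of \<alpha> i "j - i"] ij(3) by simp
      with least[of "j - i"] ij show False by simp
    qed
  qed
  have "\<alpha> ^ i = \<alpha> ^ (i mod d)" for i
    using power_add[of \<alpha> "d * (i div d)" "i mod d"] by (simp add: power_mult d)
  then have image: "(\<lambda>i. \<alpha> ^ i) ` {..<d} = UNIV - {0}"
    using primitive d(1) alpha_nonzero unfolding primitive_elem_def
    by (auto simp: image_iff) (metis lessThan_iff mod_less_divisor)
  then have "d = card (UNIV - {0 :: 'b})"
    using card_image[OF inj] by simp
  then have "d = q ^ n - 1"
    by (simp add: card_Diff_subset card_UNIV)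
  with inj image show ?thesis
    by (simp add: bij_betw_def)
qed

lemma alpha_power_order: "\<alpha> ^ (q ^ n - 1) = 1"
proof -
  have "0 < q ^ n - 1"
    using q_ge_2 n_pos one_less_power[of q n] by simp
  have "\<alpha> ^ (q ^ n - 1) \<in> UNIV - {0}"
    using alpha_nonzero by simp
  then obtain i where i: "i < q ^ n - 1" "\<alpha> ^ (q ^ n - 1) = \<alpha> ^ i"
    using alpha_power_bij unfolding bij_betw_def by (metis imageE lessThan_iff)
  then have "\<alpha> ^ (q ^ n - 1 - i) = \<alpha> ^ 0"
    using alpha_nonzero power_add[of \<alpha> i "q ^ n - 1 - i"] by simp
  \<comment> \<open>This exponent is positive and has the same power as exponent 0, so injectivity
    keeps it out of the range.\<close>
  then have "\<not> q ^ n - 1 - i < q ^ n - 1"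
    using alpha_power_bij i \<open>0 < q ^ n - 1\<close> unfolding bij_betw_def inj_on_def
    by (metis lessThan_iff zero_less_diff less_irrefl)
  then have "i = 0" using i(1) by linarith
  then show ?thesis using i(2) by simp
qed

text \<open>The index of the nonzero elements of \<open>K\<close> in the multiplicative group,
  \<open>(q ^ n - 1) / (q - 1)\<close>, as a geometric sum to avoid division.\<close>

definition M :: nat where "M = (\<Sum>i<n. q ^ i)"

lemma M: "(q - 1) * M = q ^ n - 1"
  using geometric_sum_nat[of q n] q_ge_2 by (simp add: M_def)

lemma M_pos: "0 < M"
  using n_pos q_ge_2 unfolding M_def by (intro sum_pos) auto

text \<open>A nonzero \<open>\<alpha> ^ j\<close> lies in \<open>K\<close> iff
  \<open>\<alpha> ^ (j * (q - 1)) = 1\<close>, that is, iff \<open>(q - 1) * M\<close> divides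
  \<open>j * (q - 1)\<close>, or \<open>M\<close> divides \<open>j\<close>.\<close>

lemma K_eq: "K = insert 0 ((\<lambda>i. \<alpha> ^ (M * i)) ` {..<q - 1})"
proof (intro equalityI subsetI)
  fix x assume x: "x \<in> K"
  show "x \<in> insert 0 ((\<lambda>i. \<alpha> ^ (M * i)) ` {..<q - 1})"
  proof (cases "x = 0")
    case False
    then obtain j where j: "j < q ^ n - 1" "x = \<alpha> ^ j"
      using alpha_power_bij unfolding bij_betw_def by (metis imageE lessThan_iff UNIV_I DiffI singletonD)
    have "x ^ q = x * x ^ (q - 1)"
      using q_ge_2 by (cases q) simp_all
    with x False have "x ^ (q - 1) = 1"
      by (simp add: K_def)
    then have eq: "\<alpha> ^ (j * (q - 1)) = 1"
      by (simp add: j power_mult)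
    define m where "m = j * (q - 1) mod (q ^ n - 1)"
    have "\<alpha> ^ 0 = \<alpha> ^ ((q ^ n - 1) * (j * (q - 1) div (q ^ n - 1)) + m)"
      by (simp only: m_def mult_div_mod_eq eq power_0)
    also have "\<dots> = \<alpha> ^ m"
      by (simp only: power_add power_mult alpha_power_order power_one mult_1_left)
    finally have "\<alpha> ^ m = \<alpha> ^ 0" ..
    moreover have "m < q ^ n - 1" "0 < q ^ n - 1"
      using j by (auto simp: m_def)
    ultimately have "m = 0"
      using alpha_power_bij unfolding bij_betw_def inj_on_def by (metis lessThan_iff)
    then have "q ^ n - 1 dvd j * (q - 1)"
      unfolding m_def by (simp only: mod_eq_0_iff_dvd)
    then have "(q - 1) * M dvd (q - 1) * j"
      by (simp only: M mult.commute[of j])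
    then have "M dvd j"
      by (rule nat_mult_dvd_cancel1[THEN iffD1, rotated]) (use q_ge_2 in simp)
    then obtain i where i: "j = M * i" by blast
    then have "M * i < M * (q - 1)"
      using j(1) M by (simp add: mult.commute)
    then have "i < q - 1" by simp
    with i j show ?thesis by auto
  qed simp
next
  fix x assume "x \<in> insert 0 ((\<lambda>i. \<alpha> ^ (M * i)) ` {..<q - 1})"
  moreover have "\<alpha> ^ M \<in> K"
  proof -
    have "(\<alpha> ^ M) ^ q = \<alpha> ^ M * \<alpha> ^ ((q - 1) * M)"
      using q_ge_2 by (cases q) (simp_all add: power_mult power_add mult.commute flip: power_mult)
    then show ?thesis by (simp add: K_def M alpha_power_order del: One_nat_def)
  qed
  ultimately show "x \<in> K"
    by (auto simp: K_0 power_mult intro: K_power)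
qed

lemma inj_alpha_M: "inj_on (\<lambda>i. \<alpha> ^ (M * i)) {..<q - 1}"
proof (rule inj_onI)
  fix i j assume ij: "i \<in> {..<q - 1}" "j \<in> {..<q - 1}" "\<alpha> ^ (M * i) = \<alpha> ^ (M * j)"
  then have "M * i < M * (q - 1)" "M * j < M * (q - 1)"
    using M_pos by simp_all
  then have "M * i = M * j"
    using alpha_power_bij ij(3) M unfolding bij_betw_def inj_on_def
    by (metis lessThan_iff mult.commute)
  then show "i = j" using M_pos by simp
qed

lemma card_K: "card K = q"
proof -
  have "0 \<notin> (\<lambda>i. \<alpha> ^ (M * i)) ` {..<q - 1}"
    using alpha_nonzero by auto
  then have "card K = Suc (card ((\<lambda>i. \<alpha> ^ (M * i)) ` {..<q - 1}))"
    unfolding K_eq by (intro card_insert_disjoint) auto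
  also have "\<dots> = Suc (q - 1)"
    by (simp only: card_image[OF inj_alpha_M] card_lessThan)
  finally show ?thesis using q_ge_2 by simp
qed

text \<open>For \<open>e > 0\<close>, substituting \<open>g * a\<close> for \<open>a\<close> with a
  generator \<open>g\<close> multiplies the sum by \<open>g ^ e\<close>, which is not 1.\<close>

lemma sum_K_power:
  assumes "e < q - 1"
  shows "(\<Sum>a\<in>K. a ^ e) = 0"
proof (cases "e = 0")
  case True
  \<comment> \<open>With \<open>e = 0\<close> every term is 1, including \<open>0 ^ 0\<close>, and
    the \<open>q\<close> terms add up to zero in the field.\<close>
  then show ?thesis by (simp add: card_K of_nat_q)
next
  case False
  define g where "g = \<alpha> ^ M"
  have g: "g \<in> K" "g \<noteq> 0"
    using assms False alpha_nonzero unfolding K_eq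
    by (auto simp: g_def intro!: image_eqI[of _ _ 1])
  have "g ^ e \<noteq> 1"
    using inj_onD[OF inj_alpha_M, of e 0] assms False q_ge_2 by (auto simp: g_def power_mult)
  have "(\<Sum>a\<in>K. a ^ e) = (\<Sum>a\<in>K. (g * a) ^ e)"
    by (rule sum.reindex_bij_witness[of _ "\<lambda>a. g * a" "\<lambda>a. a / g"])
      (use g in \<open>auto intro: K_mult K_divide\<close>)
  also have "\<dots> = g ^ e * (\<Sum>a\<in>K. a ^ e)"
    by (simp add: power_mult_distrib sum_distrib_left)
  finally have "(1 - g ^ e) * (\<Sum>a\<in>K. a ^ e) = 0"
    by (simp add: algebra_simps)
  with \<open>g ^ e \<noteq> 1\<close> show ?thesis by simp
qed

lemma sum_K_prod_diff_power:
  assumes "finite B" "e + card B < q - 1"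
  shows "(\<Sum>a\<in>K. (\<Prod>b\<in>B. a - b) * a ^ e) = 0"
  using prod_diff_power_sum_eq_0[OF assms, where c = "\<lambda>_. 1" and X = "\<lambda>a. a" and A = K] sum_K_power
  by simp

text \<open>Expanding the product leaves monomials in the coordinates of total degree less than
  \<open>(k + 1)(q - 1)\<close>, so some coordinate occurs with exponent below \<open>q - 1\<close>.\<close>

lemma sum_span_prod_linear:
  fixes J :: "'j set" and c :: "nat \<Rightarrow> 'j \<Rightarrow> 'b"
  assumes "finite J" "finite B" "card J + card B < Suc k * (q - 1)"
  shows "(\<Sum>t\<in>{..<Suc k} \<rightarrow>\<^sub>E K. (\<Prod>b\<in>B. t k - b) * (\<Prod>j\<in>J. \<Sum>i<Suc k. t i * c i j)) = 0"
proof -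
  \<comment> \<open>A choice function \<open>g\<close> picks one summand from each linear form.
    \<open>cnt g i\<close> is the resulting exponent of \<open>t i\<close>, and \<open>w g i\<close>
    collects all factors in that coordinate, those from \<open>B\<close> going to coordinate
    \<open>k\<close>.\<close>
  define cnt where "cnt g i = card {j \<in> J. g j = i}" for g :: "'j \<Rightarrow> nat" and i
  define w where "w g i a = (\<Prod>b\<in>(if i = k then B else {}). a - b) * a ^ cnt g i"
    for g :: "'j \<Rightarrow> nat" and i and a :: 'b
  have vanish: "(\<Sum>t\<in>{..<Suc k} \<rightarrow>\<^sub>E K. \<Prod>i<Suc k. w g i (t i)) = 0"
    if g: "g \<in> J \<rightarrow>\<^sub>E {..<Suc k}" for g
  proof -
    have "g ` J \<subseteq> {..<Suc k}" using g by auto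
    then have "card J = (\<Sum>i<Suc k. cnt g i)"
      using sum.group[OF assms(1), of "{..<Suc k}" g "\<lambda>_. 1 :: nat"] by (simp add: cnt_def)
    moreover have "card B = (\<Sum>i<Suc k. card (if i = k then B else {}))"
      by (simp add: if_distrib)
    ultimately have "(\<Sum>i<Suc k. cnt g i + card (if i = k then B else {})) < Suc k * (q - 1)"
      using assms(3) by (simp only: sum.distrib)
    then have "\<not> (\<forall>i\<in>{..<Suc k}. q - 1 \<le> cnt g i + card (if i = k then B else {}))"
      using sum_bounded_below[of "{..<Suc k}" "q - 1" "\<lambda>i. cnt g i + card (if i = k then B else {})"]
      unfolding card_lessThan of_nat_id by (meson not_le)
    then obtain i where "i \<in> {..<Suc k}" "\<not> q - 1 \<le> cnt g i + card (if i = k then B else {})"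
      by blast
    then have i: "i < Suc k" "cnt g i + card (if i = k then B else {}) < q - 1"
      by (simp_all only: lessThan_iff not_le)
    then have "(\<Sum>a\<in>K. w g i a) = 0"
      unfolding w_def using assms(2) by (intro sum_K_prod_diff_power) auto
    \<comment> \<open>The sum over all tuples factors into one sum per coordinate, and one of these
      vanishes.\<close>
    then have "(\<Prod>i<Suc k. \<Sum>a\<in>K. w g i a) = 0"
      using i(1) by (intro prod_zero) auto
    then show ?thesis by (subst (asm) prod_sum_PiE) auto
  qed
  have split: "(\<Prod>b\<in>B. t k - b) * (\<Prod>j\<in>J. t (g j) * c (g j) j) =
      (\<Prod>i<Suc k. w g i (t i)) * (\<Prod>j\<in>J. c (g j) j)"
    if g: "g \<in> J \<rightarrow>\<^sub>E {..<Suc k}" for g t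
  proof -
    have "g ` J \<subseteq> {..<Suc k}" using g by auto
    then have "(\<Prod>j\<in>J. t (g j)) = (\<Prod>i<Suc k. \<Prod>j\<in>{j \<in> J. g j = i}. t (g j))"
      by (rule prod.group[OF assms(1) finite_lessThan, symmetric])
    also have "\<dots> = (\<Prod>i<Suc k. t i ^ cnt g i)"
      by (intro prod.cong) (auto simp: cnt_def)
    finally show ?thesis
      by (simp add: w_def prod.distrib)
  qed
  have "(\<Sum>t\<in>{..<Suc k} \<rightarrow>\<^sub>E K. (\<Prod>b\<in>B. t k - b) * (\<Prod>j\<in>J. \<Sum>i<Suc k. t i * c i j)) =
    (\<Sum>t\<in>{..<Suc k} \<rightarrow>\<^sub>E K. \<Sum>g\<in>J \<rightarrow>\<^sub>E {..<Suc k}.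
      (\<Prod>b\<in>B. t k - b) * (\<Prod>j\<in>J. t (g j) * c (g j) j))"
    using assms(1) by (subst prod_sum_PiE) (auto simp: sum_distrib_left)
  also have "\<dots> = (\<Sum>g\<in>J \<rightarrow>\<^sub>E {..<Suc k}. \<Sum>t\<in>{..<Suc k} \<rightarrow>\<^sub>E K.
      (\<Prod>i<Suc k. w g i (t i)) * (\<Prod>j\<in>J. c (g j) j))"
    by (subst sum.swap) (intro sum.cong refl split)
  also have "\<dots> = 0"
    by (rule sum.neutral) (simp add: vanish del: prod.lessThan_Suc flip: sum_distrib_right)
  finally show ?thesis .
qed

text \<open>Linear independence over \<open>K\<close>, stated as injectivity of the coordinate map.
  While \<open>k < n\<close>, the span has at most \<open>q ^ k\<close> elements, so some vector
  lies outside it.\<close>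

lemma ex_independent:
  assumes "k \<le> n"
  shows "\<exists>v. inj_on (\<lambda>t. \<Sum>i<k. t i * v i) ({..<k} \<rightarrow>\<^sub>E K)"
  using assms
proof (induction k)
  case 0
  then show ?case by simp
next
  case (Suc k)
  then obtain v where inj: "inj_on (\<lambda>t. \<Sum>i<k. t i * v i) ({..<k} \<rightarrow>\<^sub>E K)" by auto
  let ?S = "(\<lambda>t. \<Sum>i<k. t i * v i) ` ({..<k} \<rightarrow>\<^sub>E K)"
  have "card ?S \<le> card ({..<k} \<rightarrow>\<^sub>E K)"
    by (intro card_image_le finite_PiE) auto
  also have "\<dots> = q ^ k"
    by (simp add: card_funcsetE card_K)
  also have "\<dots> < q ^ n"
    using Suc.prems q_ge_2 by (intro power_strict_increasing) auto
  finally have "?S \<noteq> UNIV"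
    using card_UNIV by force
  then obtain x where x: "x \<notin> ?S" by blast
  define v' where "v' = v(k := x)"
  have v': "(\<Sum>i<Suc k. t i * v' i) = (\<Sum>i<k. t i * v i) + t k * x" for t
    by (simp add: v'_def)
  have "inj_on (\<lambda>t. \<Sum>i<Suc k. t i * v' i) ({..<Suc k} \<rightarrow>\<^sub>E K)"
  proof (rule inj_onI)
    fix t t' assume t: "t \<in> {..<Suc k} \<rightarrow>\<^sub>E K" and t': "t' \<in> {..<Suc k} \<rightarrow>\<^sub>E K"
      and "(\<Sum>i<Suc k. t i * v' i) = (\<Sum>i<Suc k. t' i * v' i)"
    then have eq: "(\<Sum>i<k. t i * v i) + t k * x = (\<Sum>i<k. t' i * v i) + t' k * x"
      by (simp only: v')
    have "t k = t' k"
    proof (rule ccontr)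
      assume ne: "t k \<noteq> t' k"
      \<comment> \<open>If the last coordinates differed, solving for \<open>x\<close> would put it
        into the old span.\<close>
      have "x = ((\<Sum>i<k. t i * v i) - (\<Sum>i<k. t' i * v i)) / (t' k - t k)"
        using eq ne by (simp add: field_simps)
      also have "\<dots> = (\<Sum>i<k. (t i - t' i) / (t' k - t k) * v i)"
        by (simp add: sum_divide_distrib left_diff_distrib flip: sum_subtractf)
      also have "\<dots> = (\<Sum>i<k. restrict (\<lambda>i. (t i - t' i) / (t' k - t k)) {..<k} i * v i)"
        by (intro sum.cong) auto
      also have "\<dots> \<in> ?S"
      proof (intro imageI)
        have "(t i - t' i) / (t' k - t k) \<in> K" if "i < Suc k" for i
          using t t' that by (intro K_divide K_diff) auto
        then show "restrict (\<lambda>i. (t i - t' i) / (t' k - t k)) {..<k} \<in> {..<k} \<rightarrow>\<^sub>E K"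
          by auto
      qed
      finally show False using x by blast
    qed
    with eq have "(\<Sum>i<k. restrict t {..<k} i * v i) = (\<Sum>i<k. restrict t' {..<k} i * v i)"
      by simp
    moreover have "restrict t {..<k} \<in> {..<k} \<rightarrow>\<^sub>E K" "restrict t' {..<k} \<in> {..<k} \<rightarrow>\<^sub>E K"
      unfolding restrict_PiE_iff using PiE_mem[OF t] PiE_mem[OF t'] by simp_all
    ultimately have "restrict t {..<k} = restrict t' {..<k}"
      using inj by (simp only: inj_on_def)
    then have "t i = t' i" if "i < Suc k" for i
      using \<open>t k = t' k\<close> that by (metis lessThan_iff less_Suc_eq restrict_apply')
    then show "t = t'"
      using t t' by (intro PiE_ext) auto
  qed
  then show ?case by blast
qed

text \<open>The support is where the last coordinate avoids \<open>B\<close>, an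
  \<open>s\<close>-element subset of \<open>K\<close>. Against \<open>x ^ u\<close> the summand is a
  product of \<open>s\<close> factors in that coordinate and \<open>wtq q n u\<close> linear
  forms.\<close>

lemma ex_low_degree_function:
  assumes "k < n" "s \<le> q"
  obtains f :: "'b \<Rightarrow> 'b" where "\<And>x. f x \<in> K" "card {x. f x \<noteq> 0} = (q - s) * q ^ k"
    "\<And>u. u < q ^ n \<Longrightarrow> wtq q n u + s < Suc k * (q - 1) \<Longrightarrow> (\<Sum>x\<in>UNIV. f x * x ^ u) = 0"
proof -
  obtain B where B: "B \<subseteq> K" "card B = s" "finite B"
    using obtain_subset_with_card_n[of s K] assms(2) card_K by auto
  let ?T = "{..<Suc k} \<rightarrow>\<^sub>E K"
  obtain v where inj: "inj_on (\<lambda>t. \<Sum>i<Suc k. t i * v i) ?T" (is "inj_on ?L _")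
    using ex_independent[of "Suc k"] assms(1) by auto
  define h where "h a = (\<Prod>b\<in>B. a - b)" for a
  define f where "f x = (if x \<in> ?L ` ?T then h (the_inv_into ?T ?L x k) else 0)" for x
  have f_L: "f (?L t) = h (t k)" if "t \<in> ?T" for t
    by (simp only: f_def the_inv_into_f_f[OF inj that] imageI[OF that, of ?L] if_True)
  have h_K: "h a \<in> K" if "a \<in> K" for a
    unfolding h_def using that B by (intro K_prod K_diff) auto
  have 1: "f x \<in> K" for x
  proof (cases "x \<in> ?L ` ?T")
    case True
    then obtain t where t: "t \<in> ?T" "x = ?L t" by blast
    then have "t k \<in> K" by auto
    then show ?thesis by (simp only: t(2) f_L[OF t(1)] h_K)
  next
    case False
    then show ?thesis by (simp only: f_def if_False K_0)
  qed
  have "{x. f x \<noteq> 0} = ?L ` {t \<in> ?T. h (t k) \<noteq> 0}"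
  proof (intro equalityI subsetI)
    fix x assume "x \<in> {x. f x \<noteq> 0}"
    then have "f x \<noteq> 0" "x \<in> ?L ` ?T" by (auto simp: f_def split: if_splits)
    then obtain t where "t \<in> ?T" "x = ?L t" by blast
    with \<open>f x \<noteq> 0\<close> f_L show "x \<in> ?L ` {t \<in> ?T. h (t k) \<noteq> 0}" by auto
  next
    fix x assume "x \<in> ?L ` {t \<in> ?T. h (t k) \<noteq> 0}"
    then obtain t where "t \<in> ?T" "x = ?L t" "h (t k) \<noteq> 0" by blast
    with f_L show "x \<in> {x. f x \<noteq> 0}" by simp
  qed
  then have "card {x. f x \<noteq> 0} = card {t \<in> ?T. h (t k) \<noteq> 0}"
    using inj by (metis (no_types, lifting) card_image inj_on_subset mem_Collect_eq subsetI)
  also have "{t \<in> ?T. h (t k) \<noteq> 0} = PiE {..<Suc k} (\<lambda>i. if i = k then K - B else K)"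
  proof (rule set_eqI)
    fix t
    show "t \<in> {t \<in> ?T. h (t k) \<noteq> 0} \<longleftrightarrow> t \<in> PiE {..<Suc k} (\<lambda>i. if i = k then K - B else K)"
      using B(3) by (force simp: h_def PiE_iff less_Suc_eq)
  qed
  also have "card \<dots> = q ^ k * (q - s)"
    using B by (simp add: card_PiE card_K card_Diff_subset)
  finally have 2: "card {x. f x \<noteq> 0} = (q - s) * q ^ k" by simp
  have 3: "(\<Sum>x\<in>UNIV. f x * x ^ u) = 0"
    if u: "u < q ^ n" "wtq q n u + s < Suc k * (q - 1)" for u
  proof -
    \<comment> \<open>One index per linear form: \<open>qdigit q i u\<close> copies of the form at
      level \<open>i\<close>, so \<open>wtq q n u\<close> in all.\<close>
    let ?J = "SIGMA i:{..<n}. {..<qdigit q i u}"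
    have "(\<Sum>x\<in>UNIV. f x * x ^ u) = (\<Sum>x\<in>?L ` ?T. f x * x ^ u)"
      by (intro sum.mono_neutral_right) (auto simp: f_def)
    also have "\<dots> = (\<Sum>t\<in>?T. h (t k) * ?L t ^ u)"
      by (subst sum.reindex[OF inj]) (intro sum.cong refl, simp only: o_def f_L)
    also have "\<dots> = (\<Sum>t\<in>?T. h (t k) * (\<Prod>j\<in>?J. \<Sum>i<Suc k. t i * v i ^ q ^ fst j))"
    proof (intro sum.cong refl arg_cong2[where f = "(*)"])
      fix t assume t: "t \<in> ?T"
      \<comment> \<open>Coordinates in \<open>K\<close> are fixed by raising to
        \<open>q ^ j\<close>, so only the basis vectors change.\<close>
      have tK: "t i ^ q ^ j = t i" if "i < Suc k" for i j
      proof (induction j)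
        case (Suc j)
        have "t i \<in> K" using t that by auto
        then have "t i ^ q = t i" by (simp add: K_def)
        with Suc show ?case by (simp add: power_mult)
      qed simp
      have "?L t ^ u = (\<Prod>j<n. (?L t ^ q ^ j) ^ qdigit q j u)"
        by (rule power_eq_prod_qdigit[OF u(1)])
      also have "\<dots> = (\<Prod>j<n. (\<Sum>i<Suc k. t i * v i ^ q ^ j) ^ qdigit q j u)"
        by (intro prod.cong refl arg_cong2[where f = "(^)"])
          (simp only: power_q_sum power_mult_distrib, simp add: tK)
      also have "\<dots> = (\<Prod>j\<in>?J. \<Sum>i<Suc k. t i * v i ^ q ^ fst j)"
        by (subst prod.Sigma [symmetric, of _ _ "\<lambda>j _. \<Sum>i<Suc k. t i * v i ^ q ^ j", simplified case_prod_unfold])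
          auto
      finally show "?L t ^ u = (\<Prod>j\<in>?J. \<Sum>i<Suc k. t i * v i ^ q ^ fst j)" .
    qed
    also have "\<dots> = 0"
      unfolding h_def using u(2) B by (intro sum_span_prod_linear) (auto simp: wtq_def)
    finally show ?thesis .
  qed
  from 1 2 3 show ?thesis by (rule that)
qed

end

subsection \<open>Distances in the extended code\<close>

lemma alpha_power_in_ZrI:
  assumes "0 < u" "u \<le> q ^ (2 * m) - 1" "0 < q"
    and "int (wtq q (2 * m) u) \<le> int (2 * m) * (int q - 1) - r"
    and "int (wtq q (2 * m) u) = int (2 * m) * (int q - 1) - r \<Longrightarrow> \<bar>signed_wt q (2 * m) u\<bar> \<notin> I"
  shows "\<alpha> ^ u \<in> ZrI q m (2 * m) \<alpha> r I"
proof (cases "int (wtq q (2 * m) u) = int (2 * m) * (int q - 1) - r")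
  case True
  let ?d = "\<bar>int (Oq q (2 * m) u) - int (Eq q (2 * m) u)\<bar>"
  have "?d = \<bar>signed_wt q (2 * m) u\<bar>"
    unfolding Eq_minus_Oq[symmetric] by simp
  with abs_Oq_minus_Eq_in_Mset[OF assms(3) True] assms(5)[OF True] have "?d \<in> Mset q m r - I"
    by simp
  moreover have "\<alpha> ^ u \<in> Theta q (2 * m) \<alpha> r ?d"
    using assms(2) True unfolding Theta_def by blast
  ultimately show ?thesis unfolding ZrI_def by blast
next
  case False
  then have "\<alpha> ^ u \<in> Zset q (2 * m) \<alpha> r"
    using assms(1,2,4) unfolding Zset_def by auto
  then show ?thesis by (simp add: ZrI_def)
qed

text \<open>\<open>Theta\<close> also admits \<open>u = 0\<close>, which has weight 0; positivity of
  the critical weight rules it out.\<close>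

lemma ZrI_exponent:
  assumes "\<beta> \<in> ZrI q m n \<alpha> r I" "0 < int n * (int q - 1) - r"
  obtains u where "\<beta> = \<alpha> ^ u" "0 < u" "u \<le> q ^ n - 1" "int (wtq q n u) \<le> int n * (int q - 1) - r"
proof -
  have "0 < u" if "int (wtq q n u) = int n * (int q - 1) - r" for u
    using assms(2) that by (cases "u = 0") (auto simp: wtq_def qdigit_def)
  then show ?thesis
    using assms(1) that unfolding ZrI_def Zset_def Theta_def by fastforce
qed

context finite_extension
begin

abbreviation N :: nat where "N \<equiv> q ^ n - 1"

text \<open>The extension coordinate sits at the field element 0; since \<open>0 ^ 0 = 1\<close>, its defining equation
  becomes the vanishing of the power sum with exponent 0.\<close>

definition locator :: "nat \<Rightarrow> 'b" where
  "locator i = (if i < N then \<alpha> ^ i else 0)"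

lemma Suc_N: "{..<q ^ n} = insert N {..<N}"
proof -
  have "0 < q ^ n" using q_ge_2 by simp
  then show ?thesis by (metis Suc_diff_1 lessThan_Suc)
qed

lemma locator_bij: "bij_betw locator {..<q ^ n} UNIV"
proof -
  have "bij_betw locator {..<N} (UNIV - {0})"
    using alpha_power_bij by (rule bij_betw_cong[THEN iffD1, rotated]) (simp add: locator_def)
  then have "bij_betw locator ({..<N} \<union> {N}) ((UNIV - {0}) \<union> {0})"
    by (rule bij_betw_combine) (auto simp: locator_def)
  then show ?thesis by (simp add: Suc_N)
qed

lemma extend_word_power_sum:
  assumes "u = 0 \<or> (\<Sum>i<N. c i * (\<alpha> ^ u) ^ i) = 0"
  shows "(\<Sum>i<q ^ n. extend_word N c i * locator i ^ u) = 0"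
proof -
  have "(\<Sum>i<q ^ n. extend_word N c i * locator i ^ u) =
    (\<Sum>i<N. c i * (\<alpha> ^ u) ^ i) - (\<Sum>i<N. c i) * 0 ^ u"
    by (simp add: Suc_N extend_word_def locator_def power_mult [symmetric] mult.commute)
  then show ?thesis
    using assms by (cases "u = 0") (auto simp: power_0_left)
qed

text \<open>The difference of two words has vanishing power sums for all exponents below
  \<open>d\<close>, exponent 0 coming from the extension coordinate, so the BCH bound applies to its
  support.\<close>

lemma extended_code_dist_gt:
  assumes zeros: "\<And>u. 0 < u \<Longrightarrow> u < d \<Longrightarrow> \<alpha> ^ u \<in> Z"
    and "x \<in> extended_code N (cyclic_code q n Z)" "y \<in> extended_code N (cyclic_code q n Z)" "x \<noteq> y"
  shows "d < card {i. i < q ^ n \<and> x i \<noteq> y i}"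
proof -
  let ?A = "{i. i < q ^ n \<and> x i \<noteq> y i}"
  have sum0: "(\<Sum>i<q ^ n. z i * locator i ^ u) = 0"
    if u: "u < d" and z: "z \<in> extended_code N (cyclic_code q n Z)" for u z
  proof -
    obtain c where c: "z = extend_word N c" "c \<in> cyclic_code q n Z"
      using z unfolding extended_code_def by blast
    then have "u = 0 \<or> (\<Sum>i<N. c i * (\<alpha> ^ u) ^ i) = 0"
      using zeros[of u] u unfolding cyclic_code_def by blast
    then show ?thesis unfolding c(1) by (rule extend_word_power_sum)
  qed
  \<comment> \<open>Words are functions on all naturals; vanishing from \<open>q ^ n\<close> on
    forces distinct words to differ inside the block.\<close>
  have outside: "z i = 0" if "q ^ n \<le> i" "z \<in> extended_code N (cyclic_code q n Z)" for i z
    using that q_ge_2 by (auto simp: extended_code_def extend_word_def)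
  show ?thesis
  proof (rule bch_bound)
    show "inj_on locator ?A"
      using locator_bij by (auto simp: bij_betw_def intro: inj_on_subset)
    show "?A \<noteq> {}"
    proof
      assume "?A = {}"
      then have "x i = y i" for i
        using outside[of i x] outside[of i y] assms(2,3) by (cases "i < q ^ n") auto
      with \<open>x \<noteq> y\<close> show False by blast
    qed
    show "x i - y i \<noteq> 0" if "i \<in> ?A" for i using that by simp
    fix u assume "u < d"
    have "(\<Sum>i\<in>?A. (x i - y i) * locator i ^ u) = (\<Sum>i<q ^ n. (x i - y i) * locator i ^ u)"
      by (rule sum.mono_neutral_left) auto
    also have "\<dots> = 0"
      by (simp only: left_diff_distrib sum_subtractf sum0[OF \<open>u < d\<close>] assms(2,3) diff_self)
    finally show "(\<Sum>i\<in>?A. (x i - y i) * locator i ^ u) = 0" .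
  qed simp
qed

lemma zero_in_extended_code: "(\<lambda>_. 0 :: 'b) \<in> extended_code N (cyclic_code q n Z)"
  unfolding extended_code_def
proof (rule image_eqI)
  show "(\<lambda>_. 0) = extend_word N (\<lambda>_. 0 :: 'b)"
    by (auto simp: extend_word_def)
  show "(\<lambda>_. 0) \<in> cyclic_code q n Z"
    using q_ge_2 by (simp add: cyclic_code_def)
qed

text \<open>The word lists the values of a low degree function along the locators.\<close>

lemma ex_word_of_weight:
  assumes "k < n" "s + 2 \<le> q"
    and Z: "\<And>\<beta>. \<beta> \<in> Z \<Longrightarrow> \<exists>u. \<beta> = \<alpha> ^ u \<and> 0 < u \<and> u < q ^ n \<and> wtq q n u + s < Suc k * (q - 1)"
  obtains x where "x \<in> extended_code N (cyclic_code q n Z)"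
    "card {i. i < q ^ n \<and> x i \<noteq> 0} = (q - s) * q ^ k"
proof -
  obtain f :: "'b \<Rightarrow> 'b" where f: "\<And>x. f x \<in> K" "card {x. f x \<noteq> 0} = (q - s) * q ^ k"
    "\<And>u. u < q ^ n \<Longrightarrow> wtq q n u + s < Suc k * (q - 1) \<Longrightarrow> (\<Sum>x\<in>UNIV. f x * x ^ u) = 0"
    using ex_low_degree_function[of k s] assms(1,2) by auto
  have transfer: "(\<Sum>x\<in>UNIV. f x * x ^ u) = (\<Sum>i<N. f (\<alpha> ^ i) * (\<alpha> ^ u) ^ i) + f 0 * 0 ^ u" for u
  proof -
    have "(\<Sum>x\<in>UNIV. f x * x ^ u) = (\<Sum>i<q ^ n. f (locator i) * locator i ^ u)"
      using sum.reindex_bij_betw[OF locator_bij, of "\<lambda>x. f x * x ^ u"] by simp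
    then show ?thesis
      by (simp add: Suc_N locator_def power_mult [symmetric] mult.commute)
  qed
  define c where "c i = (if i < N then f (\<alpha> ^ i) else 0)" for i
  have "s < Suc k * (q - 1)"
    using assms(2) by simp
  then have "wtq q n 0 + s < Suc k * (q - 1)"
    by (simp add: wtq_def qdigit_def)
  \<comment> \<open>The power sum with exponent 0 vanishes, so the extension coordinate is exactly
    \<open>f 0\<close>.\<close>
  then have "(\<Sum>i<N. f (\<alpha> ^ i)) + f 0 = 0"
    using f(3)[of 0] transfer[of 0] q_ge_2 by simp
  then have x: "extend_word N c i = f (locator i)" if "i < q ^ n" for i
    using that by (auto simp: extend_word_def c_def locator_def add_eq_0_iff2 add_eq_0_iff)
  have "(\<Sum>i<N. c i * \<beta> ^ i) = 0" if \<beta>: "\<beta> \<in> Z" for \<beta>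
  proof -
    obtain u where u: "\<beta> = \<alpha> ^ u" "0 < u" "u < q ^ n" "wtq q n u + s < Suc k * (q - 1)"
      using Z[OF \<beta>] by blast
    have "(\<Sum>x\<in>UNIV. f x * x ^ u) = 0"
      by (rule f(3)[OF u(3,4)])
    then show ?thesis
      using transfer[of u] u(1,2) by (simp add: c_def zero_power)
  qed
  then have "c \<in> cyclic_code q n Z"
    using f(1) by (simp add: cyclic_code_def c_def K_def)
  then have "extend_word N c \<in> extended_code N (cyclic_code q n Z)"
    by (simp add: extended_code_def)
  moreover have "card {i. i < q ^ n \<and> extend_word N c i \<noteq> 0} = (q - s) * q ^ k"
  proof -
    have "bij_betw locator {i. i < q ^ n \<and> extend_word N c i \<noteq> 0} {x. f x \<noteq> 0}"
      using locator_bij x unfolding bij_betw_def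
      by (auto intro: inj_on_subset simp: image_iff) (metis UNIV_I imageE lessThan_iff)
    then show ?thesis using f(2) bij_betw_same_card by fastforce
  qed
  ultimately show ?thesis by (rule that)
qed

end

section \<open>Minimum distance and the three cases\<close>

lemma finite_distances:
  fixes C :: "(nat \<Rightarrow> 'a) set"
  shows "finite {card {i. i < len \<and> c i \<noteq> d i} | c d. c \<in> C \<and> d \<in> C \<and> c \<noteq> d}"
proof (rule finite_subset)
  have "card {i. i < len \<and> c i \<noteq> d i} \<le> len" for c d :: "nat \<Rightarrow> 'a"
    using card_mono[of "{..<len}" "{i. i < len \<and> c i \<noteq> d i}"] by auto
  then show "{card {i. i < len \<and> c i \<noteq> d i} | c d. c \<in> C \<and> d \<in> C \<and> c \<noteq> d} \<subseteq> {..len}"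
    by auto
qed simp

text \<open>The pair \<open>x\<close>, \<open>y\<close> makes the set of distances nonempty, so that
  its \<open>Min\<close> is an actual distance.\<close>

lemma min_dist_geI:
  assumes "\<And>c d. c \<in> C \<Longrightarrow> d \<in> C \<Longrightarrow> c \<noteq> d \<Longrightarrow> \<delta> \<le> card {i. i < len \<and> c i \<noteq> d i}"
    and "x \<in> C" "y \<in> C" "x \<noteq> y"
  shows "\<delta> \<le> min_dist len C"
  unfolding min_dist_def
proof (rule Min.boundedI[OF finite_distances])
  show "{card {i. i < len \<and> c i \<noteq> d i} | c d. c \<in> C \<and> d \<in> C \<and> c \<noteq> d} \<noteq> {}"
    using assms(2-4) by blast
qed (use assms(1) in auto)

lemma min_dist_leI:
  assumes "x \<in> C" "y \<in> C" "x \<noteq> y"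
  shows "min_dist len C \<le> card {i. i < len \<and> x i \<noteq> y i}"
  unfolding min_dist_def
proof (rule Min_le[OF finite_distances])
  show "card {i. i < len \<and> x i \<noteq> y i} \<in>
      {card {i. i < len \<and> c i \<noteq> d i} | c d. c \<in> C \<and> d \<in> C \<and> c \<noteq> d}"
    using assms by blast
qed

theorem theorem4p2:
  fixes p l q m n r \<rho> s :: nat and I :: "int set" and \<alpha> :: "'b::{field,finite}"
  assumes "prime p" and "q = p ^ l" and "m \<ge> 1" and "n = 2 * m"
    and "card (UNIV :: 'b set) = q ^ n" and "primitive_elem \<alpha>"
    and "r \<le> n * (q - 1) - 2"
    and "r = \<rho> * (q - 1) + s" and "\<rho> \<le> n - 1" and "s < q - 1"
    and "I \<subseteq> Mset q m (int r + 1)"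
  shows
   "(\<rho> = n - 1 \<and> int q - 1 - int s - 1 \<notin> I \<longrightarrow>
       min_dist (q ^ n) (Cq q m n \<alpha> (int r + 1) I) = q - s)
  \<and> (\<rho> \<le> n - 2 \<and>
       ((odd \<rho> \<and> int q - 1 - int s + 1 \<notin> I \<and> int q - 1 - int s - 1 \<notin> I) \<or>
        (even \<rho> \<and> \<bar>int s + 1\<bar> \<notin> I \<and> \<bar>int s - 1\<bar> \<notin> I)) \<longrightarrow>
       min_dist (q ^ n) (Cq q m n \<alpha> (int r + 1) I) = (q - s) * q ^ (n - \<rho> - 1))
  \<and> (\<rho> \<le> n - 2 \<and>
       ((odd \<rho> \<and> int q - 1 - int s + 1 \<in> I \<and> int q - 1 - int s - 1 \<notin> I) \<or>
        (even \<rho> \<and> s \<noteq> 0 \<and> \<bar>int s - 1\<bar> \<in> I \<and> \<bar>int s + 1\<bar> \<notin> I)) \<longrightarrow>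
       min_dist (q ^ n) (Cq q m n \<alpha> (int r + 1) I) \<ge> (q ^ 2 - q * s - 1) * q ^ (n - \<rho> - 2))"
proof -
  have q: "0 < q" "s + 2 \<le> q" using assms(10) by auto
  have "CHAR('b) = p"
    using finite_field_CHAR_eq[of p "l * n"] assms(1,2,5) by (simp add: power_mult)
  then have "\<exists>l. q = CHAR('b) ^ l"
    using assms(2) by blast
  then interpret finite_extension q n \<alpha>
    using assms(3-6) q(2) by unfold_locales (assumption | linarith)+
  define k where "k = n - \<rho> - 1"
  have k: "k < n" and n: "n = Suc k + \<rho>" using assms(3,4,9) by (auto simp: k_def)
  have parity: "even k \<longleftrightarrow> odd \<rho>"
    using n assms(4) by presburger
  have "int n * (int q - 1) = int (Suc k) * (int q - 1) + int \<rho> * (int q - 1)"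
    by (simp add: n algebra_simps)
  moreover have "int r = int \<rho> * (int q - 1) + int s"
    using assms(8) q by (simp add: of_nat_diff)
  ultimately have W: "int n * (int q - 1) - (int r + 1) = int (Suc k) * (int q - 1) - int s - 1"
    by linarith
  \<comment> \<open>The subtraction in the bound on \<open>r\<close> is truncated; this makes it
    exact and the critical weight positive.\<close>
  have "2 * 1 \<le> n * (q - 1)"
    by (rule mult_le_mono) (use assms(3,4) q in auto)
  then have "r + 2 \<le> n * (q - 1)"
    using assms(7) by linarith
  then have "int (r + 2) \<le> int (n * (q - 1))"
    by (simp only: of_nat_le_iff)
  then have "int r + 2 \<le> int n * (int q - 1)"
    using q by (simp add: of_nat_diff)
  then have W_pos: "0 < int n * (int q - 1) - (int r + 1)" by linarith
  let ?Z = "ZrI q m n \<alpha> (int r + 1) I" and ?C = "Cq q m n \<alpha> (int r + 1) I"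
  \<comment> \<open>Whatever \<open>I\<close> is, the weights of the zeros stay within reach of the
    low degree function, so the upper bound holds in every case.\<close>
  have "\<exists>u. \<beta> = \<alpha> ^ u \<and> 0 < u \<and> u < q ^ n \<and> wtq q n u + s < Suc k * (q - 1)" if \<beta>: "\<beta> \<in> ?Z" for \<beta>
  proof -
    obtain u where u: "\<beta> = \<alpha> ^ u" "0 < u" "u \<le> N"
      "int (wtq q n u) \<le> int n * (int q - 1) - (int r + 1)"
      using ZrI_exponent[OF \<beta> W_pos] .
    have "int (q - 1) = int q - 1"
      using q by linarith
    then have "int (Suc k * (q - 1)) = int (Suc k) * (int q - 1)"
      by (simp only: of_nat_mult)
    then have "wtq q n u + s < Suc k * (q - 1)"
      using u(4) unfolding W by linarith
    with u show ?thesis by (intro exI[of _ u]) auto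
  qed
  from ex_word_of_weight[OF k q(2) this] obtain w where
    w: "w \<in> ?C" "card {i. i < q ^ n \<and> w i \<noteq> 0} = (q - s) * q ^ k"
    unfolding Cq_def by blast
  have zero: "(\<lambda>_. 0) \<in> ?C" unfolding Cq_def by (rule zero_in_extended_code)
  have "0 < (q - s) * q ^ k" using q by simp
  with w(2) have "w \<noteq> (\<lambda>_. 0)" by auto
  have upper: "min_dist (q ^ n) ?C \<le> (q - s) * q ^ k"
    using min_dist_leI[OF w(1) zero \<open>w \<noteq> _\<close>, of "q ^ n"] w(2) by simp
  \<comment> \<open>All exponents \<open>0 < u < d\<close> meet the weight bound, so only those of
    critical weight could fail to be zeros.\<close>
  have lower: "d + 1 \<le> min_dist (q ^ n) ?C"
    if d: "d + 1 \<le> (q - s) * q ^ k"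
      and I: "\<And>u. u < d \<Longrightarrow> int (wtq q n u) = int (Suc k) * (int q - 1) - int s - 1 \<Longrightarrow> \<bar>signed_wt q n u\<bar> \<notin> I"
    for d
  proof (rule min_dist_geI[OF _ w(1) zero \<open>w \<noteq> _\<close>])
    have "\<alpha> ^ u \<in> ?Z" if u: "0 < u" "u < d" for u
      unfolding assms(4)
    proof (rule alpha_power_in_ZrI[OF u(1)], unfold assms(4)[symmetric] W)
      have "u + 1 < (q - s) * q ^ k" using u d by linarith
      from small_exponent_weight(1)[OF _ q(2) this, of n] k
      show "int (wtq q n u) \<le> int (Suc k) * (int q - 1) - int s - 1" by simp
      have "(q - s) * q ^ k \<le> q ^ Suc k" by simp
      also have "\<dots> \<le> q ^ n" using k q by (intro power_increasing) auto
      finally show "u \<le> q ^ n - 1" using u d by linarith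
    qed (use I u q in auto)
    then show "d + 1 \<le> card {i. i < q ^ n \<and> x i \<noteq> y i}" if "x \<in> ?C" "y \<in> ?C" "x \<noteq> y" for x y
      using extended_code_dist_gt[of d ?Z x y] that unfolding Cq_def by fastforce
  qed
  have full: "min_dist (q ^ n) ?C = (q - s) * q ^ k"
    if "\<And>u. u + 1 < (q - s) * q ^ k \<Longrightarrow> int (wtq q n u) = int (Suc k) * (int q - 1) - int s - 1 \<Longrightarrow>
      \<bar>signed_wt q n u\<bar> \<notin> I"
    using lower[of "(q - s) * q ^ k - 1"] that upper \<open>0 < (q - s) * q ^ k\<close> by fastforce
  have 1: "min_dist (q ^ n) ?C = q - s" if "\<rho> = n - 1" "int q - 1 - int s - 1 \<notin> I"
  proof -
    \<comment> \<open>The exponents in question are single digits, so \<open>u\<close> is its own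
      weight and alternating sum.\<close>
    have [simp]: "k = 0" using that(1) by (simp add: k_def)
    have "min_dist (q ^ n) ?C = (q - s) * q ^ k"
    proof (rule full)
      fix u assume u: "u + 1 < (q - s) * q ^ k" "int (wtq q n u) = int (Suc k) * (int q - 1) - int s - 1"
      then have less: "u < q ^ 1" by simp
      have "wtq q n u = u" "signed_wt q n u = int u"
        using wtq_extend[OF less, of n] signed_wt_extend[OF less, of n] k q less
        by (simp_all add: wtq_def signed_wt_def qdigit_def)
      moreover from this have "int u = int q - 1 - int s - 1" using u(2) by simp
      ultimately show "\<bar>signed_wt q n u\<bar> \<notin> I" using that(2) by (metis abs_of_nat)
    qed
    then show ?thesis by simp
  qed
  have 2: "min_dist (q ^ n) ?C = (q - s) * q ^ k"
    if "(odd \<rho> \<and> int q - 1 - int s + 1 \<notin> I \<and> int q - 1 - int s - 1 \<notin> I) \<or>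
        (even \<rho> \<and> \<bar>int s + 1\<bar> \<notin> I \<and> \<bar>int s - 1\<bar> \<notin> I)"
  proof (rule full)
    fix u assume u: "u + 1 < (q - s) * q ^ k" "int (wtq q n u) = int (Suc k) * (int q - 1) - int s - 1"
    from small_exponent_weight(2)[OF _ q(2) u] k that parity
    show "\<bar>signed_wt q n u\<bar> \<notin> I" by (auto split: if_splits)
  qed
  have 3: "(q ^ 2 - q * s - 1) * q ^ (n - \<rho> - 2) \<le> min_dist (q ^ n) ?C"
    if "\<rho> \<le> n - 2" "(odd \<rho> \<and> int q - 1 - int s - 1 \<notin> I) \<or> (even \<rho> \<and> \<bar>int s + 1\<bar> \<notin> I)"
  proof -
    define k' where "k' = n - \<rho> - 2"
    have k': "k = Suc k'" using that(1) assms(3,4) unfolding k_def k'_def by linarith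
    \<comment> \<open>The bound stops at the exponent
      \<open>(q - s) * q ^ k - q ^ (k - 1) - 1\<close>, whose digit at position \<open>k - 1\<close>
      is \<open>q - 2\<close>. Below it the third part of \<open>small_exponent_weight\<close>
      leaves one possible value.\<close>
    have "(q ^ 2 - q * s - 1) * q ^ k' = (q - s) * q ^ k - q ^ k'"
      by (simp add: k' power2_eq_square diff_mult_distrib algebra_simps)
    \<comment> \<open>This makes the truncated subtraction exact and the bound positive.\<close>
    moreover have "2 * q ^ k' \<le> (q - s) * q ^ k"
      unfolding k' using q by (intro mult_le_mono) auto
    ultimately have eq: "(q ^ 2 - q * s - 1) * q ^ k' + q ^ k' = (q - s) * q ^ k" by linarith
    moreover have "0 < q ^ k'" using q by simp
    ultimately have pos: "0 < (q ^ 2 - q * s - 1) * q ^ k'"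
      using \<open>2 * q ^ k' \<le> (q - s) * q ^ k\<close> by linarith
    have "(q ^ 2 - q * s - 1) * q ^ k' - 1 + 1 \<le> min_dist (q ^ n) ?C"
    proof (rule lower)
      show "(q ^ 2 - q * s - 1) * q ^ k' - 1 + 1 \<le> (q - s) * q ^ k"
        using eq pos by linarith
      fix u assume u: "u < (q ^ 2 - q * s - 1) * q ^ k' - 1"
        "int (wtq q n u) = int (Suc k) * (int q - 1) - int s - 1"
      then have small: "u + q ^ (k - 1) + 1 < (q - s) * q ^ k" "u + 1 < (q - s) * q ^ k"
        using eq by (simp_all add: k')
      from small_exponent_weight(3)[OF _ q(2) small(2) u(2) _ small(1)] k k' that(2) parity
      show "\<bar>signed_wt q n u\<bar> \<notin> I" by (auto split: if_splits)
    qed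
    then show ?thesis using pos by (simp add: k'_def)
  qed
  show ?thesis using 1 2 3 unfolding k_def by blast
qed

end
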